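(* Let $\mathcal H$ be a separable reproducing kernel Hilbert space and $(S_n)_{n\ge1}$ a sequence of bounded linear test-statistics (random elements of $\mathcal H^\star$). Let $c:\mathcal H\to\mathbb R$ be a deterministic functional, put $c^\star=\sup_{\omega\in\mathcal H:\|\omega\|_{\mathcal H}=1}c(\omega)$ and suppose $c^\star<\infty$. Let $\Psi_n=\sup_{\omega\in\mathcal H:\|\omega\|_{\mathcal H}=1}S_n(\omega)^2$. (a) Suppose that for each $\omega\in\mathcal H$, $S_n(\omega)\to c(\omega)$ almost surely as $n\to\infty$. Then $\lim_{n\to\infty}\Psi_n=(c^\star)^2$ almost surely if and only if for some orthonormal basis $(\phi_i)_{i\ge1}$ of $\mathcal H$ one has $\lim_{u\to\infty}\limsup_{n\to\infty}\sum_{i=u+1}^\infty S_n(\phi_i)^2=0$ almost surely. (b) Suppose that for each $\omega\in\mathcal H$, $S_n(\omega)\to c(\omega)$ in probability as $n\to\infty$. Then $\Psi_n\to(c^\star)^2$ in probability if and only if for some orthonormal basis $(\phi_i)_{i\ge1}$ of $\mathcal H$ one has $\lim_{u\to\infty}\limsup_{n\to\infty}\mathbb P\big(\sum_{i=u+1}^\infty S_n(\phi_i)^2\ge\varepsilon\big)=0$ for all $\varepsilon>0$.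
   Context: $\mathcal H^\star$ is the space of bounded linear functionals on $\mathcal H$ with the operator norm. A bounded linear test-statistic is a random variable taking values in $\mathcal H^\star$ (measurable for the Borel $\sigma$-algebra); all $S_n$ are defined on one underlying probability space. *)

theory Defs
  imports "HOL-Probability.Probability"
begin

(* A Hilbert space of real functions on 'x, represented by a Hilbert space type 'h together with
   the map as_fun sending an element of 'h to the function it stands for: as_fun is linear and injective,
   and every point evaluation is bounded. Pointwise linearity of as_fun is part of bounded_linear. *)
definition reproducing_kernel_hilbert_space ::
    "('h::{real_inner,complete_space} \<Rightarrow> 'x \<Rightarrow> real) \<Rightarrow> bool" where
  "reproducing_kernel_hilbert_space as_fun \<longleftrightarrow> inj as_fun \<and> (\<forall>t. bounded_linear (\<lambda>f. as_fun f t))"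

(* Orthonormal basis enumerated from 1. The index set is {1..} in infinite dimension and {1..d} in
   dimension d; values of \<phi> outside I are irrelevant. *)
definition orthonormal_basis_seq :: "(nat \<Rightarrow> 'h::real_inner) \<Rightarrow> nat set \<Rightarrow> bool" where
  "orthonormal_basis_seq \<phi> I \<longleftrightarrow>
     (I = {1..} \<or> (\<exists>d. I = {1..d})) \<and>
     (\<forall>i\<in>I. \<forall>j\<in>I. \<phi> i \<bullet> \<phi> j = (if i = j then 1 else 0)) \<and>
     closure (span (\<phi> ` I)) = UNIV"

(* The sum of T(\<phi> i)^2 over the basis indices i > u. It always converges, by Bessel's inequality,
   so the value 0 that infsum gives to a divergent sum does not occur for an orthonormal basis. *)
definition tail_sum ::
    "('h::{real_inner,complete_space} \<Rightarrow>\<^sub>L real) \<Rightarrow> (nat \<Rightarrow> 'h) \<Rightarrow> nat set \<Rightarrow> nat \<Rightarrow> real" where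
  "tail_sum T \<phi> I u = (\<Sum>\<^sub>\<infinity>i\<in>{i\<in>I. i \<ge> u + 1}. (blinfun_apply T (\<phi> i))\<^sup>2)"

definition converges_in_probability ::
    "'a measure \<Rightarrow> (nat \<Rightarrow> 'a \<Rightarrow> real) \<Rightarrow> real \<Rightarrow> bool" where
  "converges_in_probability M X l \<longleftrightarrow>
     (\<forall>\<epsilon>>0. (\<lambda>n. measure M {x \<in> space M. \<bar>X n x - l\<bar> > \<epsilon>}) \<longlonglongrightarrow> 0)"

end

theory Submission
  imports Defs
begin

text \<open>Pointwise limits of the functionals are unique, so \<open>c\<close> is itself a bounded functional, of norm
  \<open>c\<^sup>\<star>\<close>, and \<open>\<Psi>\<^sub>n\<close> is the squared norm of \<open>S\<^sub>n\<close>. By Parseval's identity in the dual space the tail sum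
  beyond \<open>u\<close> is \<open>\<Psi>\<^sub>n\<close> minus the head sum of \<open>S\<^sub>n(\<phi>\<^sub>i)\<^sup>2\<close>, which is a finite sum and thus converges
  to that of \<open>c\<close>. Hence for every orthonormal basis \<open>\<Psi>\<^sub>n\<close> converges iff the tails vanish uniformly
  in the limit; an orthonormal basis exists by the Gram-Schmidt process on a countable dense set.\<close>

subsection \<open>Existence of an orthonormal basis\<close>

text \<open>Degenerate steps yield the zero vector, since \<open>sgn 0 = 0\<close>.\<close>

function gram_schmidt :: "(nat \<Rightarrow> 'h::real_inner) \<Rightarrow> nat \<Rightarrow> 'h" where
  "gram_schmidt g n = sgn (g n - (\<Sum>k<n. (gram_schmidt g k \<bullet> g n) *\<^sub>R gram_schmidt g k))"
  by auto
termination
  by (relation "inv_image less_than snd") auto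

declare gram_schmidt.simps [simp del]

lemma gram_schmidt_self:
  "gram_schmidt g n \<bullet> gram_schmidt g n = (if gram_schmidt g n = 0 then 0 else 1)"
proof -
  have "norm (gram_schmidt g n) = (if gram_schmidt g n = 0 then 0 else 1)"
    by (subst (1 2) gram_schmidt.simps) (simp add: norm_sgn sgn_zero_iff)
  then show ?thesis
    by (simp add: dot_square_norm split: if_splits)
qed

text \<open>Strong induction on the larger index: the hypothesis, used in both orders, makes the
  vectors before \<open>n\<close> pairwise orthogonal, so subtracting the projections removes
  exactly the component of \<open>g n\<close> along \<open>?e m\<close>.\<close>

lemma gram_schmidt_orthogonal_less:
  "m < n \<Longrightarrow> gram_schmidt g m \<bullet> gram_schmidt g n = 0"
proof (induction n arbitrary: m rule: less_induct)
  case (less n)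
  let ?e = "gram_schmidt g"
  have orth: "?e k \<bullet> ?e m = 0" if "k < n" "k \<noteq> m" for k
    using that less.IH[of k m] less.IH[of m k] less.prems by (metis inner_commute nat_neq_iff)
  have "(\<Sum>k<n. (?e k \<bullet> g n) * (?e k \<bullet> ?e m)) = (\<Sum>k\<in>{m}. (?e k \<bullet> g n) * (?e k \<bullet> ?e m))"
    using less.prems orth by (intro sum.mono_neutral_right) auto
  \<comment> \<open>This includes the degenerate case \<open>?e m = 0\<close>, where both sides are
    0.\<close>
  also have "\<dots> = ?e m \<bullet> g n"
    by (simp add: gram_schmidt_self)
  finally have "(g n - (\<Sum>k<n. (?e k \<bullet> g n) *\<^sub>R ?e k)) \<bullet> ?e m = 0"
    by (simp add: inner_diff_left inner_sum_left inner_commute[of "g n"])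
  then have "?e n \<bullet> ?e m = 0"
    by (subst gram_schmidt.simps) (simp add: sgn_div_norm)
  then show ?case
    by (simp add: inner_commute)
qed

lemma gram_schmidt_orthogonal:
  "m \<noteq> n \<Longrightarrow> gram_schmidt g m \<bullet> gram_schmidt g n = 0"
  by (metis gram_schmidt_orthogonal_less inner_commute nat_neq_iff)

text \<open>The recursion solved for \<open>g n\<close>. It carries density of the inputs over to
  the span of the outputs.\<close>

lemma in_span_gram_schmidt: "g n \<in> span (range (gram_schmidt g))"
proof -
  define s where "s = (\<Sum>k<n. (gram_schmidt g k \<bullet> g n) *\<^sub>R gram_schmidt g k)"
  have "gram_schmidt g n = sgn (g n - s)"
    unfolding s_def by (rule gram_schmidt.simps)
  then have "g n = s + norm (g n - s) *\<^sub>R gram_schmidt g n"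
    by (cases "g n = s") (auto simp: sgn_div_norm)
  moreover have "s \<in> span (range (gram_schmidt g))"
    unfolding s_def by (intro span_sum span_scale span_base) auto
  ultimately show ?thesis
    by (metis rangeI span_add span_base span_scale)
qed

text \<open>Dropping the zero vectors from the Gram-Schmidt output keeps the span and leaves an
  orthonormal family, which is then renumbered from 1.\<close>

lemma orthonormal_basis_seq_exists:
  assumes "separable_space (euclidean :: 'h::{real_inner,complete_space} topology)"
  shows "\<exists>(\<phi> :: nat \<Rightarrow> 'h) I. orthonormal_basis_seq \<phi> I"
proof -
  obtain D :: "'h set" where D: "countable D" "closure D = UNIV"
    using assms by (auto simp: separable_space_def)
  \<comment> \<open>The empty set has empty closure. Nonemptiness gives
    \<open>from_nat_into D\<close> the range \<open>D\<close>.\<close>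
  then have "D \<noteq> {}"
    by auto
  define e where "e = gram_schmidt (from_nat_into D)"
  define J where "J = {n. e n \<noteq> 0}"
  have "D \<subseteq> span (range e)"
    using in_span_gram_schmidt D(1) \<open>D \<noteq> {}\<close>
    by (metis e_def range_from_nat_into image_subsetI)
  also have "range e \<subseteq> insert 0 (e ` J)"
    by (auto simp: J_def)
  then have "span (range e) \<subseteq> span (e ` J)"
    by (metis span_insert_0 span_mono)
  finally have dense: "closure (span (e ` J)) = UNIV"
    using D(2) closure_mono by blast
  obtain b :: "nat \<Rightarrow> nat" and I where I: "I = {1..} \<or> (\<exists>d. I = {1..d})" and b: "bij_betw b I J"
  proof (cases "finite J")
    case True
    then show ?thesis
      using ex_bij_betw_nat_finite_1[of J] that by blast
  next
    case False
    \<comment> \<open>\<open>enumerate\<close> counts from 0 and the basis from 1, hence the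
      shift.\<close>
    have "bij_betw (\<lambda>i. i - 1) {1::nat..} UNIV"
      by (rule bij_betwI[where g = Suc]) auto
    then have "bij_betw (enumerate J \<circ> (\<lambda>i. i - 1)) {1..} J"
      using bij_enumerate[OF False] bij_betw_trans by blast
    then show ?thesis
      using that by blast
  qed
  have "(e \<circ> b) i \<bullet> (e \<circ> b) j = (if i = j then 1 else 0)" if "i \<in> I" "j \<in> I" for i j
  proof (cases "i = j")
    case True
    have "e (b i) \<noteq> 0"
      using b that by (auto simp: bij_betw_def J_def)
    then show ?thesis
      using True gram_schmidt_self[of "from_nat_into D" "b j"] unfolding e_def by simp
  next
    case False
    then have "b i \<noteq> b j"
      using b that by (auto simp: bij_betw_def inj_on_def)
    then show ?thesis
      using False gram_schmidt_orthogonal unfolding e_def by simp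
  qed
  moreover have "(e \<circ> b) ` I = e ` J"
    using b by (metis bij_betw_imp_surj_on image_comp)
  ultimately have "orthonormal_basis_seq (e \<circ> b) I"
    unfolding orthonormal_basis_seq_def using I dense by simp
  then show ?thesis
    by blast
qed

subsection \<open>Norms of bounded functionals\<close>

text \<open>By homogeneity a bound on the unit sphere is a bound on the operator norm. A nonzero
  vector makes the sphere nonempty, so that the supremum is meaningful.\<close>

lemma SUP_square_eq_norm_square:
  fixes T :: "'h::real_inner \<Rightarrow>\<^sub>L real"
  assumes "\<exists>w::'h. w \<noteq> 0"
  shows "(SUP w\<in>{w. norm w = 1}. (blinfun_apply T w)\<^sup>2) = (norm T)\<^sup>2"
proof (rule antisym)
  let ?s = "SUP w\<in>{w. norm w = 1}. (blinfun_apply T w)\<^sup>2"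
  obtain w :: 'h where "w \<noteq> 0"
    using assms by blast
  then have w: "norm (sgn w) = 1"
    by (simp add: norm_sgn)
  have le: "(blinfun_apply T w)\<^sup>2 \<le> (norm T)\<^sup>2" if "norm w = 1" for w
    using norm_blinfun[of T w] that by (simp add: power2_le_iff_abs_le)
  then have bdd: "bdd_above ((\<lambda>w. (blinfun_apply T w)\<^sup>2) ` {w. norm w = 1})"
    by (intro bdd_aboveI2) auto
  show "?s \<le> (norm T)\<^sup>2"
    using w le by (intro cSUP_least) auto
  have upper: "(blinfun_apply T w)\<^sup>2 \<le> ?s" if "norm w = 1" for w
    using bdd that by (intro cSUP_upper) auto
  have "0 \<le> ?s"
    using upper[OF w] zero_le_power2 order_trans by blast
  have "\<bar>blinfun_apply T w\<bar> \<le> sqrt ?s * norm w" for w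
  proof (cases "w = 0")
    case False
    have "blinfun_apply T w = norm w * blinfun_apply T (sgn w)"
      using False by (simp add: sgn_div_norm blinfun.scaleR_right)
    moreover have "\<bar>blinfun_apply T (sgn w)\<bar> \<le> sqrt ?s"
      using upper[of "sgn w"] False by (intro real_le_rsqrt) (simp add: norm_sgn)
    ultimately show ?thesis
      by (simp add: abs_mult mult.commute mult_left_mono)
  qed (simp add: blinfun.zero_right)
  then have "norm T \<le> sqrt ?s"
    using \<open>0 \<le> ?s\<close> by (intro norm_blinfun_bound) auto
  then show "(norm T)\<^sup>2 \<le> ?s"
    using \<open>0 \<le> ?s\<close> real_sqrt_pow2 power_mono norm_ge_zero by metis
qed

text \<open>A one-sided bound suffices: the sphere is symmetric and \<open>c\<close> is odd, so the
  supremum of \<open>c\<close> is also that of its absolute value.\<close>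

lemma linear_bdd_above_sphere_blinfun:
  fixes c :: "'h::real_inner \<Rightarrow> real"
  assumes "linear c" and nontrivial: "\<exists>w::'h. w \<noteq> 0"
    and bdd: "bdd_above (c ` {w. norm w = 1})"
  obtains C where "blinfun_apply C = c" and "norm C = (SUP w\<in>{w. norm w = 1}. c w)"
proof -
  interpret linear c by fact
  let ?s = "SUP w\<in>{w. norm w = 1}. c w"
  obtain w :: 'h where "w \<noteq> 0"
    using nontrivial by blast
  then have w: "norm (sgn w) = 1"
    by (simp add: norm_sgn)
  have upper: "c w \<le> ?s" if "norm w = 1" for w
    using bdd that by (intro cSUP_upper) auto
  have abs_upper: "\<bar>c w\<bar> \<le> ?s" if "norm w = 1" for w
    using upper[of w] upper[of "- w"] that by (auto simp: neg)
  then have "0 \<le> ?s"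
    using w abs_ge_zero order_trans by blast
  have bound: "\<bar>c w\<bar> \<le> ?s * norm w" for w
  proof (cases "w = 0")
    case False
    have "c w = norm w * c (sgn w)"
      using False by (simp add: sgn_div_norm scale)
    moreover have "\<bar>c (sgn w)\<bar> \<le> ?s"
      using False by (intro abs_upper) (simp add: norm_sgn)
    ultimately show ?thesis
      by (simp add: abs_mult mult.commute mult_left_mono)
  qed (simp add: zero)
  have "bounded_linear c"
    by (rule bounded_linear_intro[where K = ?s]) (use bound add scale in \<open>simp_all add: mult.commute\<close>)
  then have C: "blinfun_apply (Blinfun c) = c"
    by (rule bounded_linear_Blinfun_apply)
  have "norm (Blinfun c) = ?s"
  proof (rule antisym)
    show "norm (Blinfun c) \<le> ?s"
      using \<open>0 \<le> ?s\<close> bound by (intro norm_blinfun_bound) (auto simp: C)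
    show "?s \<le> norm (Blinfun c)"
    proof (rule cSUP_least)
      show "{w::'h. norm w = 1} \<noteq> {}"
        using w by auto
      show "c w \<le> norm (Blinfun c)" if "w \<in> {w. norm w = 1}" for w
        using norm_blinfun[of "Blinfun c" w] that by (simp add: C)
    qed
  qed
  then show ?thesis
    using C that by blast
qed

subsection \<open>Parseval's identity in the dual space\<close>

text \<open>Its index set is the complement in \<open>I\<close> of that of \<open>tail_sum\<close>.
  Being finite, the sum passes to limits term by term.\<close>

definition head_sum :: "('h::real_inner \<Rightarrow>\<^sub>L real) \<Rightarrow> (nat \<Rightarrow> 'h) \<Rightarrow> nat set \<Rightarrow> nat \<Rightarrow> real" where
  "head_sum T \<phi> I u = (\<Sum>i | i \<in> I \<and> i \<le> u. (blinfun_apply T (\<phi> i))\<^sup>2)"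

context
  fixes \<phi> :: "nat \<Rightarrow> 'h::{real_inner,complete_space}" and I :: "nat set"
  assumes basis: "orthonormal_basis_seq \<phi> I"
begin

lemma norm_square_orthonormal_combination:
  assumes "finite F" "F \<subseteq> I"
  shows "(norm (\<Sum>i\<in>F. a i *\<^sub>R \<phi> i))\<^sup>2 = (\<Sum>i\<in>F. (a i)\<^sup>2)"
proof -
  have inner: "\<phi> i \<bullet> \<phi> j = (if i = j then 1 else 0)" if "i \<in> F" "j \<in> F" for i j
    using basis assms that unfolding orthonormal_basis_seq_def by blast
  have "(norm (\<Sum>i\<in>F. a i *\<^sub>R \<phi> i))\<^sup>2 = (\<Sum>i\<in>F. (norm (a i *\<^sub>R \<phi> i))\<^sup>2)"
    using assms inner by (intro norm_sum_Pythagorean) (auto simp: pairwise_def orthogonal_def)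
  also have "\<dots> = (\<Sum>i\<in>F. (a i)\<^sup>2)"
    using inner by (intro sum.cong) (auto simp: norm_eq_sqrt_inner)
  finally show ?thesis .
qed

text \<open>Test \<open>T\<close> on the truncated Riesz representer \<open>w\<close>: there
  \<open>T\<close> takes the value \<open>(norm w)\<^sup>2\<close>, which is at most
  \<open>norm T * norm w\<close>.\<close>

lemma bessel_dual:
  assumes "finite F" "F \<subseteq> I"
  shows "(\<Sum>i\<in>F. (blinfun_apply T (\<phi> i))\<^sup>2) \<le> (norm T)\<^sup>2"
proof -
  define s where "s = (\<Sum>i\<in>F. (blinfun_apply T (\<phi> i))\<^sup>2)"
  define w where "w = (\<Sum>i\<in>F. blinfun_apply T (\<phi> i) *\<^sub>R \<phi> i)"
  have s: "s = (norm w)\<^sup>2"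
    using norm_square_orthonormal_combination[OF assms] by (simp add: s_def w_def)
  have "blinfun_apply T w = s"
    by (simp add: w_def s_def blinfun.sum_right blinfun.scaleR_right power2_eq_square)
  then have "norm w * norm w \<le> norm T * norm w"
    using norm_blinfun[of T w] s by (simp add: power2_eq_square)
  then have "norm w \<le> norm T"
    by (cases "w = 0") auto
  then show ?thesis
    using s by (simp add: s_def power_mono)
qed

text \<open>Bessel gives summability and one inequality. For the other, Cauchy-Schwarz on
  coefficients bounds \<open>T\<close> by \<open>sqrt s\<close> on the span of the basis, and
  density extends the bound to the whole space.\<close>

lemma parseval_dual:
  "((\<lambda>i. (blinfun_apply T (\<phi> i))\<^sup>2) has_sum (norm T)\<^sup>2) I"
proof -
  let ?f = "\<lambda>i. (blinfun_apply T (\<phi> i))\<^sup>2"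
  have summable: "?f summable_on I"
    by (intro nonneg_bdd_above_summable_on bdd_aboveI2[where M = "(norm T)\<^sup>2"])
      (auto intro: bessel_dual)
  define s where "s = infsum ?f I"
  have "0 \<le> s"
    unfolding s_def by (intro infsum_nonneg) auto
  have "s \<le> (norm T)\<^sup>2"
    unfolding s_def by (intro infsum_le_finite_sums summable bessel_dual)
  have "w \<in> {w. \<bar>blinfun_apply T w\<bar> \<le> sqrt s * norm w}" if w_span: "w \<in> span (\<phi> ` I)" for w
  proof -
    obtain t r where t: "finite t" "t \<subseteq> \<phi> ` I" and w: "w = (\<Sum>a\<in>t. r a *\<^sub>R a)"
      using w_span by (auto simp: span_explicit)
    \<comment> \<open>Trades the finite set of vectors for a finite set of indices, injectively, so
      that the sum can be reindexed.\<close>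
    obtain F where F: "F \<subseteq> I" "finite F" "inj_on \<phi> F" "t = \<phi> ` F"
      using t by (auto simp: subset_image_inj finite_image_iff)
    have w: "w = (\<Sum>i\<in>F. r (\<phi> i) *\<^sub>R \<phi> i)"
      using w F by (simp add: sum.reindex)
    have "(blinfun_apply T w)\<^sup>2 = (\<Sum>i\<in>F. blinfun_apply T (\<phi> i) * r (\<phi> i))\<^sup>2"
      by (simp add: w blinfun.sum_right blinfun.scaleR_right mult.commute)
    also have "\<dots> \<le> (\<Sum>i\<in>F. ?f i) * (\<Sum>i\<in>F. (r (\<phi> i))\<^sup>2)"
      by (rule Cauchy_Schwarz_ineq_sum)
    also have "\<dots> \<le> s * (\<Sum>i\<in>F. (r (\<phi> i))\<^sup>2)"
      unfolding s_def using F summable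
      by (intro mult_right_mono finite_sum_le_infsum) (auto intro: sum_nonneg)
    also have "\<dots> = (sqrt s * norm w)\<^sup>2"
      using norm_square_orthonormal_combination[OF F(2,1)] \<open>0 \<le> s\<close> w
      by (simp add: power_mult_distrib)
    finally show ?thesis
      using \<open>0 \<le> s\<close> by (simp add: power2_le_iff_abs_le)
  qed
  moreover have "closed {w. \<bar>blinfun_apply T w\<bar> \<le> sqrt s * norm w}"
    by (intro closed_Collect_le continuous_intros)
  ultimately have "closure (span (\<phi> ` I)) \<subseteq> {w. \<bar>blinfun_apply T w\<bar> \<le> sqrt s * norm w}"
    by (intro closure_minimal) auto
  then have "\<bar>blinfun_apply T w\<bar> \<le> sqrt s * norm w" for w
    using basis unfolding orthonormal_basis_seq_def by auto
  then have "norm T \<le> sqrt s"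
    using \<open>0 \<le> s\<close> by (intro norm_blinfun_bound) auto
  then have "(norm T)\<^sup>2 \<le> s"
    using \<open>0 \<le> s\<close> by (metis norm_ge_zero power_mono real_sqrt_pow2)
  then have "s = (norm T)\<^sup>2"
    using \<open>s \<le> (norm T)\<^sup>2\<close> by simp
  then show ?thesis
    using has_sum_infsum[OF summable] s_def by simp
qed

text \<open>Parseval's sum split at \<open>u\<close>. Limits and measurability of the infinite tail
  reduce to those of a norm and a finite sum.\<close>

lemma tail_sum_eq: "tail_sum T \<phi> I u = (norm T)\<^sup>2 - head_sum T \<phi> I u"
proof -
  let ?f = "\<lambda>i. (blinfun_apply T (\<phi> i))\<^sup>2"
  have summable: "?f summable_on A" if "A \<subseteq> I" for A
    using has_sum_imp_summable[OF parseval_dual] that by (rule summable_on_subset_banach)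
  have "infsum ?f ({i\<in>I. i \<ge> u + 1} \<union> {i\<in>I. i \<le> u})
    = infsum ?f {i\<in>I. i \<ge> u + 1} + infsum ?f {i\<in>I. i \<le> u}"
    by (intro infsum_Un_disjoint summable) auto
  moreover have "{i\<in>I. i \<ge> u + 1} \<union> {i\<in>I. i \<le> u} = I"
    by auto
  ultimately show ?thesis
    using infsumI[OF parseval_dual[of T]] by (simp add: tail_sum_def head_sum_def)
qed

lemma head_sum_le: "head_sum T \<phi> I u \<le> (norm T)\<^sup>2"
  unfolding head_sum_def by (rule bessel_dual) auto

lemma head_sum_tendsto: "head_sum T \<phi> I \<longlonglongrightarrow> (norm T)\<^sup>2"
proof -
  let ?f = "\<lambda>i. (blinfun_apply T (\<phi> i))\<^sup>2"
  \<comment> \<open>Extension by 0 outside \<open>I\<close> gives a series over all naturals,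
    whether \<open>I\<close> is finite or infinite; its partial sums are the head sums.\<close>
  have "((\<lambda>i. if i \<in> I then ?f i else 0) has_sum (norm T)\<^sup>2) UNIV"
    using parseval_dual[of T] by (subst has_sum_cong_neutral[of I _ ?f]) auto
  then have "(\<lambda>u. \<Sum>i\<le>u. if i \<in> I then ?f i else 0) \<longlonglongrightarrow> (norm T)\<^sup>2"
    using has_sum_imp_sums sums_def_le by blast
  moreover have "(\<lambda>u. \<Sum>i\<le>u. if i \<in> I then ?f i else 0) = head_sum T \<phi> I"
    by (simp add: fun_eq_iff head_sum_def sum.inter_filter[symmetric] conj_commute)
  ultimately show ?thesis
    by simp
qed

end

subsection \<open>Tails of convergent arrays\<close>

text \<open>Here \<open>P\<close> stands for squared norms and \<open>H\<close> for head sums. If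
  \<open>P\<close> converges, each limsup is the limit \<open>p - h u\<close>. Conversely,
  \<open>P n - p\<close> splits into \<open>P n - H n u\<close>, \<open>H n u - h u\<close> and
  \<open>h u - p\<close>, each made smaller than \<open>e/3\<close>.\<close>

lemma tendsto_iff_limsup_tail:
  fixes P :: "nat \<Rightarrow> real" and H :: "nat \<Rightarrow> nat \<Rightarrow> real"
  assumes H: "\<And>u. (\<lambda>n. H n u) \<longlonglongrightarrow> h u" and h: "h \<longlonglongrightarrow> p"
    and le: "\<And>n u. H n u \<le> P n"
  shows "P \<longlonglongrightarrow> p \<longleftrightarrow> (\<lambda>u. limsup (\<lambda>n. ereal (P n - H n u))) \<longlonglongrightarrow> 0"
proof
  assume "P \<longlonglongrightarrow> p"
  then have "(\<lambda>n. ereal (P n - H n u)) \<longlonglongrightarrow> ereal (p - h u)" for u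
    using H by (auto intro: tendsto_diff)
  then have "limsup (\<lambda>n. ereal (P n - H n u)) = ereal (p - h u)" for u
    by (intro lim_imp_Limsup) auto
  moreover have "(\<lambda>u. p - h u) \<longlonglongrightarrow> 0"
    using tendsto_diff[OF tendsto_const h, of p] by simp
  ultimately show "(\<lambda>u. limsup (\<lambda>n. ereal (P n - H n u))) \<longlonglongrightarrow> 0"
    by (simp add: zero_ereal_def)
next
  assume lim: "(\<lambda>u. limsup (\<lambda>n. ereal (P n - H n u))) \<longlonglongrightarrow> 0"
  show "P \<longlonglongrightarrow> p"
  proof (rule tendstoI)
    fix e :: real assume "e > 0"
    then have "\<forall>\<^sub>F u in sequentially. limsup (\<lambda>n. ereal (P n - H n u)) < ereal (e/3) \<and> dist (h u) p < e/3"
      by (intro eventually_conj order_tendstoD(2)[OF lim] tendstoD[OF h]) (auto simp: zero_ereal_def)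
    then obtain u where u: "limsup (\<lambda>n. ereal (P n - H n u)) < ereal (e/3)" "dist (h u) p < e/3"
      by (auto simp: eventually_sequentially)
    \<comment> \<open>The limsup controls this difference only from above; the lower bound 0 comes
      from \<open>le\<close>.\<close>
    have "\<forall>\<^sub>F n in sequentially. P n - H n u < e/3"
      using Limsup_lessD[OF u(1)] by simp
    moreover have "\<forall>\<^sub>F n in sequentially. dist (H n u) (h u) < e/3"
      using \<open>e > 0\<close> by (intro tendstoD[OF H]) auto
    ultimately show "\<forall>\<^sub>F n in sequentially. dist (P n) p < e"
    proof eventually_elim
      case (elim n)
      then show ?case
        using u(2) le[of n u] unfolding dist_real_def by linarith
    qed
  qed
qed

subsection \<open>Convergence in probability\<close>

context prob_space
begin

lemma converges_in_probability_const: "converges_in_probability M (\<lambda>n x. l) l"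
  by (simp add: converges_in_probability_def)

text \<open>Only the deviation events of \<open>X\<close> and \<open>Y\<close> need to be measurable: those of \<open>f (X n, Y n)\<close>
  are bounded through monotonicity of the measure in its larger argument.\<close>

lemma converges_in_probability_continuous2:
  fixes f :: "real \<times> real \<Rightarrow> real"
  assumes X: "converges_in_probability M X l" and Y: "converges_in_probability M Y m"
    and [measurable]: "\<And>n. n \<ge> 1 \<Longrightarrow> X n \<in> borel_measurable M" "\<And>n. n \<ge> 1 \<Longrightarrow> Y n \<in> borel_measurable M"
    and f: "isCont f (l, m)"
  shows "converges_in_probability M (\<lambda>n x. f (X n x, Y n x)) (f (l, m))"
  unfolding converges_in_probability_def
proof (intro allI impI)
  fix \<epsilon> :: real assume "\<epsilon> > 0"
  then obtain d where d: "d > 0" "\<And>z. dist z (l, m) < d \<Longrightarrow> dist (f z) (f (l, m)) < \<epsilon>"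
    using f unfolding continuous_at_eps_delta by blast
  \<comment> \<open>Outside both events the pair is within \<open>2 * d/3 < d\<close> of
    \<open>(l, m)\<close>, as the norm of a pair is at most the sum of the norms.\<close>
  define A where "A n = {x \<in> space M. \<bar>X n x - l\<bar> > d/3}" for n
  define B where "B n = {x \<in> space M. \<bar>Y n x - m\<bar> > d/3}" for n
  have "d/3 > 0"
    using d(1) by simp
  then have lim: "(\<lambda>n. prob (A n) + prob (B n)) \<longlonglongrightarrow> 0"
    using X Y unfolding converges_in_probability_def A_def B_def
    by (intro tendsto_add_zero) blast+
  have "prob {x \<in> space M. \<bar>f (X n x, Y n x) - f (l, m)\<bar> > \<epsilon>} \<le> prob (A n) + prob (B n)" if "n \<ge> 1" for n
  proof -
    have [measurable]: "A n \<in> events" "B n \<in> events"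
      unfolding A_def B_def using that by measurable
    have "x \<in> A n \<union> B n" if "x \<in> space M" "\<bar>f (X n x, Y n x) - f (l, m)\<bar> > \<epsilon>" for x
    proof (rule ccontr)
      assume "x \<notin> A n \<union> B n"
      then have "\<bar>X n x - l\<bar> \<le> d/3" "\<bar>Y n x - m\<bar> \<le> d/3"
        using that(1) by (auto simp: A_def B_def)
      then have "dist (X n x, Y n x) (l, m) < d"
        using norm_Pair_le[of "X n x - l" "Y n x - m"] d(1) by (auto simp: dist_norm)
      then show False
        using d(2) that(2) by (fastforce simp: dist_real_def)
    qed
    then have "prob {x \<in> space M. \<bar>f (X n x, Y n x) - f (l, m)\<bar> > \<epsilon>} \<le> prob (A n \<union> B n)"
      by (intro finite_measure_mono) auto
    also have "\<dots> \<le> prob (A n) + prob (B n)"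
      by (intro measure_Un_le) auto
    finally show ?thesis .
  qed
  then show "(\<lambda>n. prob {x \<in> space M. \<bar>f (X n x, Y n x) - f (l, m)\<bar> > \<epsilon>}) \<longlonglongrightarrow> 0"
    by (intro tendsto_sandwich[OF _ _ tendsto_const lim] eventually_sequentiallyI[of 1]) auto
qed

text \<open>Otherwise a deviation above half the distance would have probability 1. Applied to the
  difference of a sequence with itself, this yields uniqueness of limits in probability.\<close>

lemma converges_in_probability_unique_const:
  assumes "converges_in_probability M (\<lambda>n x. l) m"
  shows "l = m"
proof (rule ccontr)
  assume "l \<noteq> m"
  then have "(\<lambda>n::nat. prob {x \<in> space M. \<bar>l - m\<bar> > \<bar>l - m\<bar> / 2}) \<longlonglongrightarrow> 0"
    using assms unfolding converges_in_probability_def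
    by (elim allE[of _ "\<bar>l - m\<bar> / 2"]) simp
  moreover have "prob {x \<in> space M. \<bar>l - m\<bar> > \<bar>l - m\<bar> / 2} = 1"
    using \<open>l \<noteq> m\<close> by (simp add: prob_space)
  ultimately show False
    by (simp add: LIMSEQ_const_iff)
qed

lemma converges_in_probability_sum:
  assumes "finite F"
    and "\<And>i. i \<in> F \<Longrightarrow> converges_in_probability M (X i) (l i)"
    and "\<And>i n. i \<in> F \<Longrightarrow> n \<ge> 1 \<Longrightarrow> X i n \<in> borel_measurable M"
  shows "converges_in_probability M (\<lambda>n x. \<Sum>i\<in>F. X i n x) (\<Sum>i\<in>F. l i)"
  using assms
proof (induction F rule: finite_induct)
  case empty
  then show ?case
    by (simp add: converges_in_probability_const)
next
  case (insert j F)
  have "converges_in_probability M (\<lambda>n x. fst (X j n x, \<Sum>i\<in>F. X i n x) + snd (X j n x, \<Sum>i\<in>F. X i n x))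
    (fst (l j, \<Sum>i\<in>F. l i) + snd (l j, \<Sum>i\<in>F. l i))"
    using insert
    by (intro converges_in_probability_continuous2[of _ _ _ _ "\<lambda>z. fst z + snd z"] continuous_intros) auto
  then show ?case
    using insert by simp
qed

text \<open>The same splitting as for deterministic arrays, with events in place of inequalities and
  a union bound in place of the triangle inequality.\<close>

lemma converges_in_probability_iff_limsup_tail:
  fixes P :: "nat \<Rightarrow> 'a \<Rightarrow> real" and H :: "nat \<Rightarrow> 'a \<Rightarrow> nat \<Rightarrow> real"
  assumes H: "\<And>u. converges_in_probability M (\<lambda>n x. H n x u) (h u)" and h: "h \<longlonglongrightarrow> p"
    and le: "\<And>n x u. H n x u \<le> P n x"
    and P_measurable [measurable]: "\<And>n. n \<ge> 1 \<Longrightarrow> P n \<in> borel_measurable M"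
    and H_measurable [measurable]: "\<And>n u. n \<ge> 1 \<Longrightarrow> (\<lambda>x. H n x u) \<in> borel_measurable M"
  shows "converges_in_probability M P p \<longleftrightarrow>
    (\<forall>\<epsilon>>0. (\<lambda>u. limsup (\<lambda>n. ereal (prob {x \<in> space M. P n x - H n x u \<ge> \<epsilon>}))) \<longlonglongrightarrow> 0)"
proof (intro iffI allI impI)
  fix \<epsilon> :: real
  assume P: "converges_in_probability M P p" and "\<epsilon> > 0"
  \<comment> \<open>The difference converges in probability to \<open>p - h u\<close>, which lies
    below \<open>\<epsilon>/2\<close>; reaching \<open>\<epsilon>\<close> is thus a deviation above
    \<open>\<epsilon>/2\<close>, and the limsup is exactly 0 for all large \<open>u\<close>.\<close>
  have "limsup (\<lambda>n. ereal (prob {x \<in> space M. P n x - H n x u \<ge> \<epsilon>})) = 0" if "dist (h u) p < \<epsilon>/2" for u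
  proof -
    define A where "A n = {x \<in> space M. \<bar>(P n x - H n x u) - (p - h u)\<bar> > \<epsilon>/2}" for n
    have "converges_in_probability M (\<lambda>n x. fst (P n x, H n x u) - snd (P n x, H n x u)) (fst (p, h u) - snd (p, h u))"
      using P H
      by (intro converges_in_probability_continuous2[of _ _ _ _ "\<lambda>z. fst z - snd z"] continuous_intros) auto
    then have lim: "(\<lambda>n. prob (A n)) \<longlonglongrightarrow> 0"
      unfolding converges_in_probability_def A_def fst_conv snd_conv
      using half_gt_zero[OF \<open>\<epsilon> > 0\<close>] by blast
    have "prob {x \<in> space M. P n x - H n x u \<ge> \<epsilon>} \<le> prob (A n)" if "n \<ge> 1" for n
    proof (rule finite_measure_mono)
      show "A n \<in> events"
        unfolding A_def using that by measurable
      show "{x \<in> space M. P n x - H n x u \<ge> \<epsilon>} \<subseteq> A n"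
        using \<open>dist (h u) p < \<epsilon>/2\<close> unfolding A_def dist_real_def by (smt (verit) Collect_mono field_sum_of_halves)
    qed
    then have "(\<lambda>n. prob {x \<in> space M. P n x - H n x u \<ge> \<epsilon>}) \<longlonglongrightarrow> 0"
      by (intro tendsto_sandwich[OF _ _ tendsto_const lim] eventually_sequentiallyI[of 1]) auto
    then show ?thesis
      by (intro lim_imp_Limsup) (auto simp: zero_ereal_def)
  qed
  moreover have "\<forall>\<^sub>F u in sequentially. dist (h u) p < \<epsilon>/2"
    using \<open>\<epsilon> > 0\<close> by (intro tendstoD[OF h]) auto
  ultimately show "(\<lambda>u. limsup (\<lambda>n. ereal (prob {x \<in> space M. P n x - H n x u \<ge> \<epsilon>}))) \<longlonglongrightarrow> 0"
    by (intro tendsto_eventually) (auto elim: eventually_mono)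
next
  assume tail: "\<forall>\<epsilon>>0. (\<lambda>u. limsup (\<lambda>n. ereal (prob {x \<in> space M. P n x - H n x u \<ge> \<epsilon>}))) \<longlonglongrightarrow> 0"
  show "converges_in_probability M P p"
    unfolding converges_in_probability_def
  proof (intro allI impI)
    fix \<epsilon> :: real assume "\<epsilon> > 0"
    show "(\<lambda>n. prob {x \<in> space M. \<bar>P n x - p\<bar> > \<epsilon>}) \<longlonglongrightarrow> 0"
    proof (rule tendstoI)
      fix \<delta> :: real assume "\<delta> > 0"
      have "\<epsilon>/3 > 0"
        using \<open>\<epsilon> > 0\<close> by simp
      define A where "A u n = {x \<in> space M. P n x - H n x u \<ge> \<epsilon>/3}" for u n
      define B where "B u n = {x \<in> space M. \<bar>H n x u - h u\<bar> > \<epsilon>/3}" for u n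
      have lim: "(\<lambda>u. limsup (\<lambda>n. ereal (prob (A u n)))) \<longlonglongrightarrow> 0"
        using tail \<open>\<epsilon>/3 > 0\<close> unfolding A_def by blast
      \<comment> \<open>\<open>u\<close> is fixed before \<open>n\<close>. Then a deviation of
        \<open>P\<close> above \<open>\<epsilon>\<close> forces \<open>A\<close> or
        \<open>B\<close>, each eventually of probability below \<open>\<delta>/2\<close>.\<close>
      have "\<forall>\<^sub>F u in sequentially. limsup (\<lambda>n. ereal (prob (A u n))) < ereal (\<delta>/2) \<and> dist (h u) p < \<epsilon>/3"
        using \<open>\<delta> > 0\<close> \<open>\<epsilon> > 0\<close>
        by (intro eventually_conj order_tendstoD(2)[OF lim] tendstoD[OF h]) (auto simp: zero_ereal_def)
      then obtain u where u: "limsup (\<lambda>n. ereal (prob (A u n))) < ereal (\<delta>/2)" "dist (h u) p < \<epsilon>/3"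
        by (auto simp: eventually_sequentially)
      have "(\<lambda>n. prob (B u n)) \<longlonglongrightarrow> 0"
        using H[of u] \<open>\<epsilon>/3 > 0\<close> unfolding converges_in_probability_def B_def by blast
      then have "\<forall>\<^sub>F n in sequentially. prob (B u n) < \<delta>/2"
        using \<open>\<delta> > 0\<close> by (intro order_tendstoD) auto
      moreover have "\<forall>\<^sub>F n in sequentially. prob (A u n) < \<delta>/2"
        using Limsup_lessD[OF u(1)] by simp
      moreover have "\<forall>\<^sub>F n in sequentially. n \<ge> (1::nat)"
        by (rule eventually_ge_at_top)
      ultimately show "\<forall>\<^sub>F n in sequentially. dist (prob {x \<in> space M. \<bar>P n x - p\<bar> > \<epsilon>}) 0 < \<delta>"
      proof eventually_elim
        case (elim n)
        have [measurable]: "A u n \<in> events" "B u n \<in> events"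
          unfolding A_def B_def using elim(3) by measurable
        have "x \<in> A u n \<union> B u n" if "x \<in> space M" "\<bar>P n x - p\<bar> > \<epsilon>" for x
        proof (cases "x \<in> B u n")
          case False
          then have "\<bar>H n x u - h u\<bar> \<le> \<epsilon>/3"
            using that(1) by (simp add: B_def)
          then have "P n x - H n x u \<ge> \<epsilon>/3"
            using that(2) u(2) le[of n x u] unfolding dist_real_def by linarith
          then show ?thesis
            using that(1) by (simp add: A_def)
        qed simp
        then have "prob {x \<in> space M. \<bar>P n x - p\<bar> > \<epsilon>} \<le> prob (A u n \<union> B u n)"
          by (intro finite_measure_mono) auto
        also have "\<dots> \<le> prob (A u n) + prob (B u n)"
          by (intro measure_Un_le) auto
        finally show ?case
          using elim by simp
      qed
    qed
  qed
qed

section \<open>Linearity of the limit functional\<close>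

text \<open>Each identity involves at most three vectors, hence finitely many null sets. It does not
  depend on the sample point, so holding almost surely in a probability space it holds
  outright.\<close>

lemma linear_if_converges_AE:
  fixes S :: "nat \<Rightarrow> 'a \<Rightarrow> 'h::real_normed_vector \<Rightarrow>\<^sub>L real" and c :: "'h \<Rightarrow> real"
  assumes "\<And>w. AE x in M. (\<lambda>n. blinfun_apply (S n x) w) \<longlonglongrightarrow> c w"
  shows "linear c"
proof (rule linearI)
  fix v w and r :: real
  have "AE x in M. c (v + w) = c v + c w"
    using assms[of v] assms[of w] assms[of "v + w"]
  proof eventually_elim
    case (elim x)
    then show ?case
      using LIMSEQ_unique[OF _ tendsto_add[OF elim(1,2)]] by (simp add: blinfun.add_right)
  qed
  then show "c (v + w) = c v + c w"
    by simp
  have "AE x in M. c (r *\<^sub>R w) = r * c w"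
    using assms[of w] assms[of "r *\<^sub>R w"]
  proof eventually_elim
    case (elim x)
    then show ?case
      using LIMSEQ_unique[OF _ tendsto_mult_left[OF elim(1), of r]] by (simp add: blinfun.scaleR_right)
  qed
  then show "c (r *\<^sub>R w) = r *\<^sub>R c w"
    by simp
qed

lemma linear_if_converges_in_probability:
  fixes S :: "nat \<Rightarrow> 'a \<Rightarrow> 'h::real_normed_vector \<Rightarrow>\<^sub>L real" and c :: "'h \<Rightarrow> real"
  assumes conv: "\<And>w. converges_in_probability M (\<lambda>n x. blinfun_apply (S n x) w) (c w)"
    and meas: "\<And>n w. n \<ge> 1 \<Longrightarrow> (\<lambda>x. blinfun_apply (S n x) w) \<in> borel_measurable M"
  shows "linear c"
proof (rule linearI)
  have combination: "c (a *\<^sub>R v + b *\<^sub>R w) = a * c v + b * c w" for a b v w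
  proof -
    have "converges_in_probability M
        (\<lambda>n x. a * fst (blinfun_apply (S n x) v, blinfun_apply (S n x) w) + b * snd (blinfun_apply (S n x) v, blinfun_apply (S n x) w))
        (a * fst (c v, c w) + b * snd (c v, c w))"
      by (intro converges_in_probability_continuous2[of _ _ _ _ "\<lambda>z. a * fst z + b * snd z"]
          conv meas continuous_intros)
    then have *: "converges_in_probability M (\<lambda>n x. blinfun_apply (S n x) (a *\<^sub>R v + b *\<^sub>R w)) (a * c v + b * c w)"
      by (simp add: blinfun.add_right blinfun.scaleR_right)
    \<comment> \<open>One sequence with two limits: its difference with itself is constantly 0 and
      converges in probability to the difference of the limits.\<close>
    have "converges_in_probability M
        (\<lambda>n x. (\<lambda>z. fst z - snd z) (blinfun_apply (S n x) (a *\<^sub>R v + b *\<^sub>R w), blinfun_apply (S n x) (a *\<^sub>R v + b *\<^sub>R w)))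
        ((\<lambda>z. fst z - snd z) (c (a *\<^sub>R v + b *\<^sub>R w), a * c v + b * c w))"
      by (intro converges_in_probability_continuous2 conv * meas continuous_intros)
    then show ?thesis
      using converges_in_probability_unique_const by fastforce
  qed
  show "c (v + w) = c v + c w" for v w
    using combination[of 1 v 1 w] by simp
  show "c (r *\<^sub>R w) = r *\<^sub>R c w" for r w
    using combination[of r w 0 w] by simp
qed

end

section \<open>The two equivalences for random functionals\<close>

theorem theorem3:
  fixes as_fun :: "'h::{real_inner,complete_space} \<Rightarrow> 'x \<Rightarrow> real"
    and M :: "'a measure"
    and S :: "nat \<Rightarrow> 'a \<Rightarrow> ('h \<Rightarrow>\<^sub>L real)"
    and c :: "'h \<Rightarrow> real"
    and cstar :: real
    and \<Psi> :: "nat \<Rightarrow> 'a \<Rightarrow> real"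
  assumes rkhs: "reproducing_kernel_hilbert_space as_fun"
    and separable: "separable_space (euclidean :: 'h topology)"
    and nontrivial: "\<exists>w::'h. w \<noteq> 0"
    and prob_space: "prob_space M"
    and S_measurable: "\<And>n. n \<ge> 1 \<Longrightarrow> S n \<in> measurable M borel"
    and c_bounded: "bdd_above (c ` {w. norm w = 1})"
  defines "cstar \<equiv> (SUP w\<in>{w. norm w = 1}. c w)"
    and "\<Psi> \<equiv> (\<lambda>n x. SUP w\<in>{w. norm w = 1}. (blinfun_apply (S n x) w)\<^sup>2)"
  shows
    "((\<forall>w. AE x in M. (\<lambda>n. blinfun_apply (S n x) w) \<longlonglongrightarrow> c w) \<longrightarrow>
       ((AE x in M. (\<lambda>n. \<Psi> n x) \<longlonglongrightarrow> cstar\<^sup>2) \<longleftrightarrow>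
        (\<exists>\<phi> I. orthonormal_basis_seq \<phi> I \<and>
          (AE x in M. (\<lambda>u. limsup (\<lambda>n. ereal (tail_sum (S n x) \<phi> I u))) \<longlonglongrightarrow> 0))))
     \<and>
     ((\<forall>w. converges_in_probability M (\<lambda>n x. blinfun_apply (S n x) w) (c w)) \<longrightarrow>
       (converges_in_probability M \<Psi> (cstar\<^sup>2) \<longleftrightarrow>
        (\<exists>\<phi> I. orthonormal_basis_seq \<phi> I \<and>
          (\<forall>\<epsilon>>0. (\<lambda>u. limsup (\<lambda>n. ereal (measure M {x \<in> space M. tail_sum (S n x) \<phi> I u \<ge> \<epsilon>})))
             \<longlonglongrightarrow> 0))))"
proof -
  interpret prob_space M by fact
  have \<Psi>_eq: "\<Psi> = (\<lambda>n x. (norm (S n x))\<^sup>2)"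
    unfolding \<Psi>_def using SUP_square_eq_norm_square[OF nontrivial] by simp
  have apply_measurable [measurable]: "(\<lambda>x. blinfun_apply (S n x) w) \<in> borel_measurable M" if "n \<ge> 1" for n w
    using S_measurable[OF that]
    by (rule borel_measurable_continuous_on[rotated]) (intro continuous_intros)
  have \<Psi>_measurable: "\<Psi> n \<in> borel_measurable M" if "n \<ge> 1" for n
    unfolding \<Psi>_eq using S_measurable[OF that]
    by (rule borel_measurable_continuous_on[rotated]) (intro continuous_intros)
  obtain \<phi>0 :: "nat \<Rightarrow> 'h" and I0 where basis0: "orthonormal_basis_seq \<phi>0 I0"
    using orthonormal_basis_seq_exists[OF separable] by blast
  have functional: "\<exists>C. blinfun_apply C = c \<and> norm C = cstar" if "linear c"
    using linear_bdd_above_sphere_blinfun[OF that nontrivial c_bounded] unfolding cstar_def by metis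
  have almost_sure:
    "(AE x in M. (\<lambda>n. \<Psi> n x) \<longlonglongrightarrow> cstar\<^sup>2) \<longleftrightarrow>
     (AE x in M. (\<lambda>u. limsup (\<lambda>n. ereal (tail_sum (S n x) \<phi> I u))) \<longlonglongrightarrow> 0)"
    if conv: "\<And>w. AE x in M. (\<lambda>n. blinfun_apply (S n x) w) \<longlonglongrightarrow> c w"
      and basis: "orthonormal_basis_seq \<phi> I" for \<phi> I
  proof -
    obtain C where C: "blinfun_apply C = c" "norm C = cstar"
      using functional[OF linear_if_converges_AE[OF conv]] by blast
    \<comment> \<open>The exceptional null set depends on the vector; countably many basis vectors
      share a single one.\<close>
    have "AE x in M. \<forall>i. (\<lambda>n. blinfun_apply (S n x) (\<phi> i)) \<longlonglongrightarrow> c (\<phi> i)"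
      using conv by (simp add: AE_all_countable)
    \<comment> \<open>The equivalence holds at almost every sample point, so the two almost sure
      statements are equivalent.\<close>
    then have "AE x in M. ((\<lambda>n. \<Psi> n x) \<longlonglongrightarrow> cstar\<^sup>2) \<longleftrightarrow>
      ((\<lambda>u. limsup (\<lambda>n. ereal (tail_sum (S n x) \<phi> I u))) \<longlonglongrightarrow> 0)"
    proof eventually_elim
      case (elim x)
      have "(\<lambda>n. head_sum (S n x) \<phi> I u) \<longlonglongrightarrow> head_sum C \<phi> I u" for u
        unfolding head_sum_def C using elim by (intro tendsto_intros) auto
      then show ?case
        unfolding \<Psi>_eq tail_sum_eq[OF basis] C(2)[symmetric]
        using head_sum_tendsto[OF basis] head_sum_le[OF basis] by (rule tendsto_iff_limsup_tail)
    qed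
    then show ?thesis
      by (intro eventually_subst)
  qed
  have in_probability:
    "converges_in_probability M \<Psi> (cstar\<^sup>2) \<longleftrightarrow>
     (\<forall>\<epsilon>>0. (\<lambda>u. limsup (\<lambda>n. ereal (measure M {x \<in> space M. tail_sum (S n x) \<phi> I u \<ge> \<epsilon>}))) \<longlonglongrightarrow> 0)"
    if conv: "\<And>w. converges_in_probability M (\<lambda>n x. blinfun_apply (S n x) w) (c w)"
      and basis: "orthonormal_basis_seq \<phi> I" for \<phi> I
  proof -
    obtain C where C: "blinfun_apply C = c" "norm C = cstar"
      using functional[OF linear_if_converges_in_probability[OF conv apply_measurable]] by blast
    have "converges_in_probability M (\<lambda>n x. (blinfun_apply (S n x) w)\<^sup>2) ((c w)\<^sup>2)" for w
      using converges_in_probability_continuous2[OF conv conv apply_measurable apply_measurable,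
          of w w "\<lambda>z. (fst z)\<^sup>2"] by simp
    then have "converges_in_probability M (\<lambda>n x. head_sum (S n x) \<phi> I u) (head_sum C \<phi> I u)" for u
      unfolding head_sum_def C by (intro converges_in_probability_sum) auto
    then show ?thesis
      unfolding tail_sum_eq[OF basis] C(2)[symmetric]
      using head_sum_tendsto[OF basis] head_sum_le[OF basis] \<Psi>_measurable
      unfolding \<Psi>_eq
      by (rule converges_in_probability_iff_limsup_tail) (auto simp: head_sum_def)
  qed
  \<comment> \<open>Both equivalences hold for every orthonormal basis: any basis serves from right
    to left, and \<open>\<phi>0\<close> is the witness from left to right.\<close>
  show ?thesis
    using almost_sure in_probability basis0 by blast
qed

end
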